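(* Let $X$ be a topological space. The following are equivalent: (i) $X$ is strongly $\mathcal{K}$-analytic. (ii) There exist a compact topological space $\Omega$, a strongly $\mathcal{K}_{\sigma\delta}$ subset $C$ of $\Omega$, and a compact covering map $f\colon C\to X$.
   Context: All topological spaces are Hausdorff and completely regular. For a topological space $X$, $\mathcal{K}(X)$ denotes the set of nonempty compact subsets of $X$, and $\Sigma=\mathbb{N}^{\mathbb{N}}$ carries the product topology (the Baire space). A map $F\colon Y\to\mathcal{K}(X)$, where $Y$ is a topological space, is usco (upper semicontinuous) if for every $y\in Y$ and every open $V\subseteq X$ with $F(y)\subseteq V$ there is a neighbourhood $W$ of $y$ with $\bigcup_{t\in W}F(t)\subseteq V$. A topological space $X$ is strongly $\mathcal{K}$-analytic if there is an usco map $F\colon\Sigma\to\mathcal{K}(X)$ with $\bigcup_{\sigma\in\Sigma}F(\sigma)=X$ such that for each compact $L\subseteq X$ there is $\sigma\in\Sigma$ with $L\subseteq F(\sigma)$. A subset $A$ of a topological space $Y$ is called strongly $\mathcal{K}_{\sigma\delta}$ if there is a countable family $\{K_{n,m}: n,m\in\mathbb{N}\}$ of compact subsets of $Y$ such that $A=\bigcap_{n=1}^\infty\bigcup_{m=1}^\infty K_{n,m}$ and for each compact subset $L$ of $A$ and each $n\in\mathbb{N}$ there exists $m\in\mathbb{N}$ with $L\subseteq K_{n,m}$. A continuous map $f\colon C\to X$ is compact covering if for every compact $L\subseteq X$ there is a compact $K\subseteq C$ with $f(K)=L$. Here $C$ carries the relative topology of $\Omega$.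
   Formalization: The space X is assumed nonempty: for empty X, (ii) holds with C empty, but (i) fails because usco maps take nonempty compact values, so the equivalence as stated fails exactly for the empty space. *)

theory Defs
  imports "HOL-Analysis.Analysis"
begin

text \<open>
  All spaces are abstract topologies. The standing convention "Hausdorff and completely regular" is
  not built into the notions below, except for the space \<Omega> in \<open>compact_covering_from\<close>, where it
  has to be imposed on a quantified space.
\<close>

definition nonempty_compacts :: "'a topology \<Rightarrow> 'a set set" where
  "nonempty_compacts X = {K. compactin X K \<and> K \<noteq> {}}"

definition baire_space :: "(nat \<Rightarrow> nat) topology" where
  "baire_space = product_topology (\<lambda>_. discrete_topology UNIV) UNIV"

definition usco_map :: "'b topology \<Rightarrow> 'a topology \<Rightarrow> ('b \<Rightarrow> 'a set) \<Rightarrow> bool" where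
  "usco_map Y X F \<longleftrightarrow>
     F \<in> topspace Y \<rightarrow> nonempty_compacts X \<and>
     (\<forall>y\<in>topspace Y. \<forall>V. openin X V \<and> F y \<subseteq> V \<longrightarrow>
        (\<exists>W. openin Y W \<and> y \<in> W \<and> (\<Union>t\<in>W. F t) \<subseteq> V))"

text \<open>
  Values of usco maps are nonempty, so the empty space is never strongly K-analytic, although it is
  trivially a compact covering image; statements relating the two need a nonempty space.
\<close>

definition strongly_K_analytic :: "'a topology \<Rightarrow> bool" where
  "strongly_K_analytic X \<longleftrightarrow>
     (\<exists>F. usco_map baire_space X F \<and>
          (\<Union>\<sigma>\<in>topspace baire_space. F \<sigma>) = topspace X \<and>
          (\<forall>L. compactin X L \<longrightarrow> (\<exists>\<sigma>\<in>topspace baire_space. L \<subseteq> F \<sigma>)))"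

definition strongly_K_sigma_delta :: "'b topology \<Rightarrow> 'b set \<Rightarrow> bool" where
  "strongly_K_sigma_delta Y A \<longleftrightarrow>
     (\<exists>K :: nat \<Rightarrow> nat \<Rightarrow> 'b set.
        (\<forall>n m. compactin Y (K n m)) \<and>
        A = (\<Inter>n. \<Union>m. K n m) \<and>
        (\<forall>L. compactin Y L \<and> L \<subseteq> A \<longrightarrow> (\<forall>n. \<exists>m. L \<subseteq> K n m)))"

definition compact_covering_map :: "'b topology \<Rightarrow> 'a topology \<Rightarrow> ('b \<Rightarrow> 'a) \<Rightarrow> bool" where
  "compact_covering_map C X f \<longleftrightarrow>
     continuous_map C X f \<and>
     (\<forall>L. compactin X L \<longrightarrow> (\<exists>K. compactin C K \<and> f ` K = L))"

definition compact_covering_from :: "'b topology \<Rightarrow> 'a topology \<Rightarrow> bool" where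
  "compact_covering_from \<Omega> X \<longleftrightarrow>
     compact_space \<Omega> \<and> Hausdorff_space \<Omega> \<and> completely_regular_space \<Omega> \<and>
     (\<exists>C f. strongly_K_sigma_delta \<Omega> C \<and> compact_covering_map (subtopology \<Omega> C) X f)"

text \<open>
  The existential quantifier over all compact spaces cannot range over types inside a formula. It is
  therefore witnessed in a type depending only on the type of \<open>X\<close>: every completely regular Hausdorff
  space on \<open>'a\<close> embeds in a cube inside \<open>('a \<Rightarrow> real) \<Rightarrow> real\<close>, and the other factor
  \<open>nat \<Rightarrow> real\<close> has room for a metrizable compactification of the Baire space. The converse
  implication should be stated for \<Omega> on an arbitrary type, so that this choice loses nothing.
\<close>

type_synonym 'a compact_carrier = "(nat \<Rightarrow> real) \<times> (('a \<Rightarrow> real) \<Rightarrow> real)"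

end

theory Submission
  imports Defs
begin

text \<open>
  From a representation \<open>C = (\<Inter>n. \<Union>m. K n m)\<close> and a compact covering map \<open>f\<close>, the usco map is
  \<open>\<sigma> \<mapsto> f ` (\<Inter>n. K n (\<sigma> n))\<close>, with one fixed point of \<open>X\<close> added to every value to keep
  the values nonempty. Conversely, \<open>C\<close> is the graph of the usco map, placed in the product of a
  metrizable compactification of the Baire space and a cube containing \<open>X\<close>, and \<open>f\<close> is the second
  projection. The graph is cut out by the closures of its parts over
  \<open>{\<sigma>. \<forall>i<n. \<sigma> i \<le> m}\<close>: they are compact, a compact subset of the graph is bounded in each
  coordinate of \<open>\<sigma>\<close>, and upper semicontinuity prevents the closures from adding points over the
  Baire space.
\<close>

section \<open>Cylinders of the Baire space, usco maps, nested compact sets\<close>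

lemma topspace_baire_space [simp]: "topspace baire_space = UNIV"
  by (simp add: baire_space_def)

lemma openin_baire_cylinder: "openin baire_space {\<tau>. \<forall>i<n. \<tau> i = \<sigma> i}"
proof -
  have "{\<tau>. \<forall>i<n. \<tau> i = \<sigma> i} = (\<Pi>\<^sub>E i\<in>UNIV. if i < n then {\<sigma> i} else UNIV)"
    by (fastforce simp: PiE_iff split: if_splits)
  moreover have "openin baire_space \<dots>"
    unfolding baire_space_def
    by (rule product_topology_basis) (auto intro: finite_subset[of _ "{..<n}"] split: if_splits)
  ultimately show ?thesis by simp
qed

lemma openin_baire_contains_cylinder:
  assumes "openin baire_space W" "\<sigma> \<in> W"
  obtains n where "{\<tau>. \<forall>i<n. \<tau> i = \<sigma> i} \<subseteq> W"
proof -
  obtain S where S: "\<sigma> \<in> (\<Pi>\<^sub>E i\<in>UNIV. S i)" "finite {i. S i \<noteq> UNIV}" "(\<Pi>\<^sub>E i\<in>UNIV. S i) \<subseteq> W"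
    using product_topology_open_contains_basis[OF assms[unfolded baire_space_def]] by auto
  obtain n where n: "{i. S i \<noteq> UNIV} \<subseteq> {..<n}"
    using S(2) finite_nat_bounded by blast
  have "\<tau> \<in> W" if "\<forall>i<n. \<tau> i = \<sigma> i" for \<tau>
  proof -
    have "\<tau> i \<in> S i" for i
      using S(1) n that by (cases "i < n") (auto simp: PiE_iff)
    then show ?thesis using S(3) by (auto simp: PiE_iff)
  qed
  then show thesis using that by blast
qed

lemma usco_map_compose_continuous:
  assumes F: "usco_map Y X F" and e: "continuous_map X Z e"
  shows "usco_map Y Z (\<lambda>y. e ` F y)"
  unfolding usco_map_def
proof (intro conjI ballI allI impI)
  show "(\<lambda>y. e ` F y) \<in> topspace Y \<rightarrow> nonempty_compacts Z"
    using F e by (auto simp: usco_map_def nonempty_compacts_def Pi_iff intro: image_compactin)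
next
  fix y V assume y: "y \<in> topspace Y" and V: "openin Z V \<and> e ` F y \<subseteq> V"
  let ?V = "{x \<in> topspace X. e x \<in> V}"
  have "F y \<subseteq> topspace X"
    using F y by (auto simp: usco_map_def nonempty_compacts_def Pi_iff dest: compactin_subset_topspace)
  then have "openin X ?V" "F y \<subseteq> ?V"
    using V e openin_continuous_map_preimage by blast+
  then obtain W where "openin Y W" "y \<in> W" "(\<Union>t\<in>W. F t) \<subseteq> ?V"
    using F y unfolding usco_map_def by meson
  then show "\<exists>W. openin Y W \<and> y \<in> W \<and> (\<Union>t\<in>W. e ` F t) \<subseteq> V"
    by blast
qed

text \<open>An open set containing \<open>insert a (G y)\<close> already contains \<open>a\<close>,
  so the neighbourhood that works for \<open>G\<close> works after the insertion. The sets
  \<open>G y\<close> themselves may be empty.\<close>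

lemma usco_map_insert:
  assumes vals: "\<And>y. y \<in> topspace Y \<Longrightarrow> compactin X (G y)"
    and usc: "\<And>y V. \<lbrakk>y \<in> topspace Y; openin X V; G y \<subseteq> V\<rbrakk>
               \<Longrightarrow> \<exists>W. openin Y W \<and> y \<in> W \<and> (\<Union>t\<in>W. G t) \<subseteq> V"
    and "a \<in> topspace X"
  shows "usco_map Y X (\<lambda>y. insert a (G y))"
  unfolding usco_map_def
proof (intro conjI ballI allI impI)
  have "compactin X (insert a (G y))" if "y \<in> topspace Y" for y
    using compactin_Un[of X "{a}" "G y"] vals[OF that] \<open>a \<in> topspace X\<close> by simp
  then show "(\<lambda>y. insert a (G y)) \<in> topspace Y \<rightarrow> nonempty_compacts X"
    by (auto simp: nonempty_compacts_def)
next
  fix y V assume "y \<in> topspace Y" "openin X V \<and> insert a (G y) \<subseteq> V"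
  then show "\<exists>W. openin Y W \<and> y \<in> W \<and> (\<Union>t\<in>W. insert a (G t)) \<subseteq> V"
    using usc[of y V] by auto
qed

text \<open>Otherwise the finite intersections minus \<open>U\<close> form a decreasing sequence of
  nonempty closed subsets of the compact \<open>K 0\<close>. Their common point would lie in every
  \<open>K n\<close> but outside \<open>U\<close>.\<close>

lemma Inter_compactin_subset_openin:
  assumes "Hausdorff_space Y" "\<And>n. compactin Y (K n)" "openin Y U" "(\<Inter>n. K n) \<subseteq> U"
  obtains N :: nat where "(\<Inter>n\<le>N. K n) \<subseteq> U"
proof -
  have K: "closedin Y (K n)" for n
    using assms compactin_imp_closedin by blast
  have "\<exists>N. (\<Inter>n\<le>N. K n) - U = {}"
  proof (rule ccontr)
    assume "\<nexists>N. (\<Inter>n\<le>N. K n) - U = {}"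
    then have ne: "(\<Inter>n\<le>N. K n) - U \<noteq> {}" for N by blast
    define D where "D N = (\<Inter>n\<le>N. K n) - U" for N
    have D: "closedin Y (D N)" for N
      unfolding D_def using assms(3) K by (intro closedin_diff closedin_INT) auto
    have D0: "D N \<subseteq> K 0" for N by (auto simp: D_def)
    have "(\<Inter>N. D N) \<noteq> {}"
    proof (rule compact_space_imp_nest[of "subtopology Y (K 0)"])
      show "compact_space (subtopology Y (K 0))"
        using assms(2) compactin_subspace by blast
      show "closedin (subtopology Y (K 0)) (D N)" for N
        using D D0 closedin_subset_topspace by blast
      show "D N \<noteq> {}" for N using ne by (simp add: D_def)
      show "decseq D"
        by (fastforce simp: decseq_def D_def)
    qed
    then show False using assms(4) by (auto simp: D_def)
  qed
  then show thesis using that by blast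
qed

section \<open>From a compact covering map to an usco map\<close>

lemma compact_covering_from_imp_strongly_K_analytic:
  fixes \<Omega> :: "'b topology"
  assumes "compact_covering_from \<Omega> X" "topspace X \<noteq> {}"
  shows "strongly_K_analytic X"
proof -
  obtain C f where haus: "Hausdorff_space \<Omega>"
    and "strongly_K_sigma_delta \<Omega> C" and "compact_covering_map (subtopology \<Omega> C) X f"
    using assms(1) by (auto simp: compact_covering_from_def)
  then have f: "continuous_map (subtopology \<Omega> C) X f"
    and cov: "\<And>L. compactin X L \<Longrightarrow> \<exists>M. compactin (subtopology \<Omega> C) M \<and> f ` M = L"
    by (auto simp: compact_covering_map_def)
  obtain K :: "nat \<Rightarrow> nat \<Rightarrow> 'b set" where K: "\<And>n m. compactin \<Omega> (K n m)"
    and C: "C = (\<Inter>n. \<Union>m. K n m)"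
    and strong: "\<And>L n. \<lbrakk>compactin \<Omega> L; L \<subseteq> C\<rbrakk> \<Longrightarrow> \<exists>m. L \<subseteq> K n m"
    using \<open>strongly_K_sigma_delta \<Omega> C\<close> unfolding strongly_K_sigma_delta_def by (elim exE conjE) blast
  obtain a where a: "a \<in> topspace X" using assms(2) by blast
  define G where "G \<sigma> = (\<Inter>n. K n (\<sigma> n))" for \<sigma> :: "nat \<Rightarrow> nat"
  have G_sub: "G \<sigma> \<subseteq> C" for \<sigma> by (auto simp: G_def C)
  have "closedin \<Omega> (G \<sigma>)" for \<sigma>
    unfolding G_def using K haus compactin_imp_closedin by (intro closedin_INT) auto
  then have "compactin \<Omega> (G \<sigma>)" for \<sigma>
    using closed_compactin[OF K[of 0 "\<sigma> 0"], of "G \<sigma>"] by (auto simp: G_def)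
  then have G: "compactin (subtopology \<Omega> C) (G \<sigma>)" for \<sigma>
    using G_sub by (simp add: compactin_subtopology)
  let ?F = "\<lambda>\<sigma>. insert a (f ` G \<sigma>)"
  have "usco_map baire_space X ?F"
  proof (rule usco_map_insert[OF _ _ a])
    show "compactin X (f ` G \<sigma>)" for \<sigma>
      using G f image_compactin by blast
  next
    fix \<sigma> V assume "openin X V" "f ` G \<sigma> \<subseteq> V"
    have "openin (subtopology \<Omega> C) {c \<in> topspace (subtopology \<Omega> C). f c \<in> V}"
      using f \<open>openin X V\<close> openin_continuous_map_preimage by blast
    \<comment> \<open>Continuity of \<open>f\<close> is known only on \<open>C\<close>, while finite
      intersections of the \<open>K n (\<sigma> n)\<close> may leave \<open>C\<close>. So the
      preimage of \<open>V\<close> is written as the trace of an open \<open>U\<close> of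
      \<open>\<Omega>\<close>, where compactness can be applied.\<close>
    then obtain U where U: "openin \<Omega> U" "{c \<in> topspace (subtopology \<Omega> C). f c \<in> V} = U \<inter> C"
      by (auto simp: openin_subtopology)
    have "G \<sigma> \<subseteq> U"
      using U(2) \<open>f ` G \<sigma> \<subseteq> V\<close> compactin_subset_topspace[OF G[of \<sigma>]] by blast
    then obtain N where N: "(\<Inter>n\<le>N. K n (\<sigma> n)) \<subseteq> U"
      using Inter_compactin_subset_openin[OF haus, of "\<lambda>n. K n (\<sigma> n)" U] K U(1)
      unfolding G_def by blast
    \<comment> \<open>The indices up to and including \<open>N\<close> matter, hence
      \<open>Suc N\<close> coordinates: \<open>G \<tau>\<close> then lies in the same finite
      intersection as \<open>G \<sigma>\<close>.\<close>
    have "f ` G \<tau> \<subseteq> V" if "\<forall>i<Suc N. \<tau> i = \<sigma> i" for \<tau>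
    proof -
      have "G \<tau> \<subseteq> (\<Inter>n\<le>N. K n (\<sigma> n))"
        using that by (auto simp: G_def less_Suc_eq_le) (metis)
      then have "G \<tau> \<subseteq> U \<inter> C" using N G_sub[of \<tau>] by simp
      then show ?thesis unfolding U(2)[symmetric] by auto
    qed
    then show "\<exists>W. openin baire_space W \<and> \<sigma> \<in> W \<and> (\<Union>\<tau>\<in>W. f ` G \<tau>) \<subseteq> V"
      using openin_baire_cylinder[of "Suc N" \<sigma>]
      by (intro exI[of _ "{\<tau>. \<forall>i<Suc N. \<tau> i = \<sigma> i}"]) auto
  qed
  moreover have cover: "\<exists>\<sigma>\<in>topspace baire_space. L \<subseteq> ?F \<sigma>" if "compactin X L" for L
  proof -
    obtain M where M: "compactin (subtopology \<Omega> C) M" "f ` M = L"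
      using cov \<open>compactin X L\<close> by blast
    then have "\<forall>n. \<exists>m. M \<subseteq> K n m"
      using strong by (simp add: compactin_subtopology)
    \<comment> \<open>Choosing one such \<open>m\<close> for each \<open>n\<close> gives a single
      sequence whose \<open>G \<sigma>\<close> contains all of \<open>M\<close>.\<close>
    then obtain \<sigma> where "\<And>n. M \<subseteq> K n (\<sigma> n)" by metis
    then have "M \<subseteq> G \<sigma>" by (auto simp: G_def)
    then show ?thesis using M(2) by auto
  qed
  moreover have "(\<Union>\<sigma>\<in>topspace baire_space. ?F \<sigma>) = topspace X"
  proof
    show "(\<Union>\<sigma>\<in>topspace baire_space. ?F \<sigma>) \<subseteq> topspace X"
      using a image_compactin[OF G f] compactin_subset_topspace by fastforce
    show "topspace X \<subseteq> (\<Union>\<sigma>\<in>topspace baire_space. ?F \<sigma>)"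
      using cover[of "{x}" for x] by fastforce
  qed
  ultimately show ?thesis
    unfolding strongly_K_analytic_def by blast
qed

section \<open>The graph of an usco map in a compact product\<close>

abbreviation hilbert_cube :: "(nat \<Rightarrow> real) topology" where
  "hilbert_cube \<equiv> product_topology (\<lambda>_. top_of_set {0..1}) UNIV"

text \<open>Reciprocals turn the naturals into isolated points converging to 0, and
  \<open>Suc\<close> keeps the values away from that limit. A positive lower bound on a coordinate
  thus bounds \<open>\<sigma> i\<close> from above.\<close>

definition baire_embedding :: "(nat \<Rightarrow> nat) \<Rightarrow> nat \<Rightarrow> real" where
  "baire_embedding \<sigma> i = inverse (real (Suc (\<sigma> i)))"

lemma baire_embedding_in_cube: "baire_embedding \<sigma> \<in> topspace hilbert_cube"
  by (auto simp: baire_embedding_def field_simps)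

lemma baire_embedding_isolated:
  "\<exists>N. open N \<and> (\<forall>\<sigma>. baire_embedding \<sigma> i \<in> N \<longleftrightarrow> \<sigma> i = k)"
proof (intro exI conjI allI)
  \<comment> \<open>The interval between the two neighbouring reciprocals. For \<open>k = 0\<close>
    there is no larger one, and \<open>inverse 0 = 0\<close> as an upper end would make the interval
    empty.\<close>
  let ?N = "{inverse (real (Suc (Suc k)))<..} \<inter> (if k = 0 then UNIV else {..<inverse (real k)})"
  show "open ?N" by auto
  show "baire_embedding \<sigma> i \<in> ?N \<longleftrightarrow> \<sigma> i = k" for \<sigma>
    by (cases k) (auto simp: baire_embedding_def simp del: of_nat_Suc)
qed

lemma strongly_K_sigma_delta_usco_graph:
  assumes F: "usco_map baire_space Z F" and Z: "compact_space Z" "Hausdorff_space Z"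
  shows "strongly_K_sigma_delta (prod_topology hilbert_cube Z)
           {(baire_embedding \<sigma>, x) |\<sigma> x. x \<in> F \<sigma>}"
    (is "strongly_K_sigma_delta ?P ?C")
proof -
  \<comment> \<open>The first \<open>n\<close> coordinates are bounded rather than prescribed: a
    compact subset of the graph may involve several prefixes, but one \<open>m\<close> bounds them
    all.\<close>
  define R where "R n m = {(baire_embedding \<sigma>, x) |\<sigma> x. x \<in> F \<sigma> \<and> (\<forall>i<n. \<sigma> i \<le> m)}" for n m :: nat
  define K where "K n m = ?P closure_of R n m" for n m
  have FZ: "compactin Z (F \<sigma>)" for \<sigma>
    using F by (auto simp: usco_map_def nonempty_compacts_def Pi_iff)
  then have FZ': "F \<sigma> \<subseteq> topspace Z" for \<sigma>
    using compactin_subset_topspace by blast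
  have R_sub: "R n m \<subseteq> topspace ?P" for n m
    using FZ' baire_embedding_in_cube by (fastforce simp: R_def)
  have R_K: "R n m \<subseteq> K n m" for n m
    unfolding K_def by (rule closure_of_subset[OF R_sub])
  have "compact_space hilbert_cube"
    by (simp add: compact_space_product_topology compact_space_subtopology)
  then have P: "compact_space ?P"
    using Z by (simp add: compact_space_prod_topology)
  then have K: "compactin ?P (K n m)" for n m
    unfolding K_def by (simp add: closedin_compact_space)
  have coord: "continuous_map ?P euclideanreal (\<lambda>z. fst z i)" for i
    using continuous_map_prod_fst[of i UNIV "top_of_set {0..1}" Z]
    by (auto simp: continuous_map_in_subtopology)

  have strong: "\<exists>m. L \<subseteq> K n m" if L: "compactin ?P L" "L \<subseteq> ?C" for L n
  proof -
    \<comment> \<open>The \<open>i\<close>-th coordinate attains its minimum on a nonempty compact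
      \<open>L\<close>. As \<open>L\<close> lies in the graph, the minimum is the reciprocal of some
      \<open>Suc (\<rho> i)\<close>, and \<open>\<rho> i\<close> is the bound.\<close>
    have "\<exists>m. \<forall>\<sigma> x. (baire_embedding \<sigma>, x) \<in> L \<longrightarrow> \<sigma> i \<le> m" for i
    proof (cases "L = {}")
      case False
      let ?I = "(\<lambda>z. fst z i) ` L"
      have "compact ?I"
        using image_compactin[OF L(1) coord[of i]] by simp
      then obtain s where s: "s \<in> ?I" "\<forall>t\<in>?I. s \<le> t"
        using compact_attains_inf[of ?I] False by blast
      obtain \<rho> where "s = baire_embedding \<rho> i"
        using s(1) L(2) by fastforce
      have "\<sigma> i \<le> \<rho> i" if "(baire_embedding \<sigma>, x) \<in> L" for \<sigma> x
      proof -
        have "baire_embedding \<rho> i \<le> baire_embedding \<sigma> i"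
          using s(2) that \<open>s = baire_embedding \<rho> i\<close> by force
        then show ?thesis
          by (simp add: baire_embedding_def)
      qed
      then show ?thesis by blast
    qed auto
    then obtain b where b: "\<And>i \<sigma> x. (baire_embedding \<sigma>, x) \<in> L \<Longrightarrow> \<sigma> i \<le> b i"
      by metis
    \<comment> \<open>The sum serves as a common bound for the first \<open>n\<close> values and
      also makes sense for \<open>n = 0\<close>.\<close>
    have "b i \<le> (\<Sum>j<n. b j)" if "i < n" for i
      using that by (intro member_le_sum) auto
    then have "\<sigma> i \<le> (\<Sum>j<n. b j)" if "(baire_embedding \<sigma>, x) \<in> L" "i < n" for \<sigma> x i
      using b[OF that(1)] that(2) le_trans by blast
    then have "L \<subseteq> R n (\<Sum>j<n. b j)"
      using L(2) unfolding R_def by blast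
    then have "L \<subseteq> K n (\<Sum>j<n. b j)"
      using R_K by (rule subset_trans)
    then show ?thesis ..
  qed

  have "(\<Inter>n. \<Union>m. K n m) \<subseteq> ?C"
  proof
    fix z assume z: "z \<in> (\<Inter>n. \<Union>m. K n m)"
    obtain y x where [simp]: "z = (y, x)" by (cases z)
    have "\<forall>n. \<exists>m. (y, x) \<in> K n m" using z by auto
    then obtain \<mu> where \<mu>: "\<And>n. (y, x) \<in> K n (\<mu> n)" by metis
    have xZ: "x \<in> topspace Z"
      using \<mu>[of 0] by (auto simp: K_def in_closure_of)
    \<comment> \<open>Level \<open>Suc i\<close> is the first that bounds coordinate
      \<open>i\<close>. On \<open>R (Suc i) (\<mu> (Suc i))\<close> this coordinate takes finitely
      many values; a finite set is closed, so the closure adds no value, in particular not the limit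
      0.\<close>
    have "\<exists>k. y i = inverse (real (Suc k))" for i
    proof -
      let ?A = "(\<lambda>k. inverse (real (Suc k))) ` {..\<mu> (Suc i)}"
      have "closedin ?P {w \<in> topspace ?P. fst w i \<in> ?A}"
        using coord by (rule closedin_continuous_map_preimage) (simp add: finite_imp_closed)
      then have "fst (y, x) i \<in> ?A"
        by (rule forall_in_closure_of[OF \<mu>[of "Suc i", unfolded K_def], rotated])
          (auto simp: R_def baire_embedding_def)
      then show ?thesis by auto
    qed
    then obtain \<sigma> where "\<And>i. y i = inverse (real (Suc (\<sigma> i)))" by metis
    then have y: "y = baire_embedding \<sigma>" by (auto simp: baire_embedding_def)
    have "x \<in> F \<sigma>"
    proof (rule ccontr)
      assume "x \<notin> F \<sigma>"
      then obtain U V where UV: "openin Z U" "openin Z V" "x \<in> U" "F \<sigma> \<subseteq> V" "disjnt U V"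
        using Hausdorff_space_compact_separation[OF Z(2), of "{x}" "F \<sigma>"] xZ FZ by auto
      obtain W where "openin baire_space W" "\<sigma> \<in> W" and W: "(\<Union>t\<in>W. F t) \<subseteq> V"
        using F UV(2,4) unfolding usco_map_def topspace_baire_space by (meson UNIV_I)
      then obtain n where n: "{\<tau>. \<forall>i<n. \<tau> i = \<sigma> i} \<subseteq> W"
        using openin_baire_contains_cylinder by blast
      have "\<forall>i. \<exists>N. open N \<and> (\<forall>\<tau>. baire_embedding \<tau> i \<in> N \<longleftrightarrow> \<tau> i = \<sigma> i)"
        using baire_embedding_isolated by blast
      from choice[OF this] obtain N where N_open: "\<And>i. open (N i)"
        and N_iff: "\<And>i \<tau>. baire_embedding \<tau> i \<in> N i \<longleftrightarrow> \<tau> i = \<sigma> i"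
        by blast
      \<comment> \<open>\<open>Q\<close> is a neighbourhood of \<open>(y, x)\<close> whose points
        over the Baire space have first coordinate in the cylinder of \<open>\<sigma>\<close>. It
        meets \<open>R n (\<mu> n)\<close> in a graph point
        \<open>(baire_embedding \<tau>, t)\<close>; then \<open>t\<close> lies in \<open>U\<close>,
        and in \<open>V\<close> by upper semicontinuity.\<close>
      define Q where "Q = {w \<in> topspace ?P. (\<forall>i<n. fst w i \<in> N i) \<and> snd w \<in> U}"
      have Q: "openin ?P Q"
      proof -
        let ?A = "\<Inter>i\<in>{..<n}. {w \<in> topspace ?P. fst w i \<in> N i}"
        have "openin ?P {w \<in> topspace ?P. fst w i \<in> N i}" for i
          using N_open openin_continuous_map_preimage[OF coord] by simp
        \<comment> \<open>For \<open>n = 0\<close> the set \<open>?A\<close> is \<open>UNIV\<close>,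
          so the intersection with \<open>topspace ?P\<close> is kept.\<close>
        then have "openin ?P (?A \<inter> topspace ?P)"
          by (intro openin_INT) simp_all
        moreover have "openin ?P {w \<in> topspace ?P. snd w \<in> U}"
          by (rule openin_continuous_map_preimage[OF continuous_map_snd UV(1)])
        ultimately have "openin ?P (?A \<inter> topspace ?P \<inter> {w \<in> topspace ?P. snd w \<in> U})"
          by (rule openin_Int)
        also have "?A \<inter> topspace ?P \<inter> {w \<in> topspace ?P. snd w \<in> U} = Q"
          by (auto simp: Q_def)
        finally show ?thesis .
      qed
      have "(y, x) \<in> topspace ?P"
        using y xZ baire_embedding_in_cube by simp
      then have "(y, x) \<in> Q"
        using y UV(3) N_iff by (simp add: Q_def)
      then obtain w where w: "w \<in> R n (\<mu> n)" "w \<in> Q"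
        using \<mu>[of n] Q unfolding K_def in_closure_of by blast
      then obtain \<tau> t where "w = (baire_embedding \<tau>, t)" "t \<in> F \<tau>"
        unfolding R_def by blast
      then have "\<forall>i<n. \<tau> i = \<sigma> i" "t \<in> U"
        using w(2) N_iff by (auto simp: Q_def)
      then show False
        using \<open>t \<in> F \<tau>\<close> n W UV(5) by (auto simp: disjnt_iff)
    qed
    then show "z \<in> ?C" using y by auto
  qed
  moreover have "?C \<subseteq> (\<Inter>n. \<Union>m. K n m)"
  proof -
    \<comment> \<open>Singletons are compact, so the covering property for compact sets also gives
      this inclusion.\<close>
    have "\<exists>m. {c} \<subseteq> K n m" if "c \<in> ?C" for c n
    proof (rule strong)
      show "compactin ?P {c}"
        using that FZ' baire_embedding_in_cube by fastforce
    qed (use that in auto)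
    then show ?thesis by blast
  qed
  ultimately have "?C = (\<Inter>n. \<Union>m. K n m)" by (rule equalityI[rotated])
  then show ?thesis
    unfolding strongly_K_sigma_delta_def using K strong
    by (intro exI[of _ K]) simp
qed

section \<open>From an usco map to a compact covering map\<close>

lemma strongly_K_analytic_imp_compact_covering_from:
  fixes X :: "'a topology"
  assumes "Hausdorff_space X" "completely_regular_space X" "strongly_K_analytic X"
  shows "\<exists>\<Omega> :: 'a compact_carrier topology. compact_covering_from \<Omega> X"
proof -
  obtain I :: "('a \<Rightarrow> real) set" and e :: "'a \<Rightarrow> ('a \<Rightarrow> real) \<Rightarrow> real"
    where emb: "embedding_map X (product_topology (\<lambda>_. top_of_set {0..1}) I) e"
    using completely_regular_space_cube_embedding assms(1,2) by blast
  define Z where "Z = product_topology (\<lambda>_. top_of_set {0..1::real}) I"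
  obtain e' where hom: "homeomorphic_maps X (subtopology Z (e ` topspace X)) e e'"
    using emb unfolding embedding_map_def homeomorphic_map_maps Z_def by blast
  have e: "continuous_map X Z e"
    and e': "continuous_map (subtopology Z (e ` topspace X)) X e'"
    and e'e: "\<And>x. x \<in> topspace X \<Longrightarrow> e' (e x) = x"
    using hom by (auto simp: homeomorphic_maps_def continuous_map_in_subtopology)
  have Z: "compact_space Z" "Hausdorff_space Z"
    unfolding Z_def
    by (simp_all add: compact_space_product_topology compact_space_subtopology
        Hausdorff_space_product_topology Hausdorff_space_subtopology)
  define \<Omega> where "\<Omega> = prod_topology hilbert_cube Z"
  have \<Omega>: "compact_space \<Omega>" "Hausdorff_space \<Omega>"
    unfolding \<Omega>_def using Z
    by (simp_all add: compact_space_prod_topology Hausdorff_space_prod_topology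
        compact_space_product_topology compact_space_subtopology
        Hausdorff_space_product_topology Hausdorff_space_subtopology)
  then have "completely_regular_space \<Omega>"
    by (simp add: compact_Hausdorff_or_regular_imp_normal_space normal_imp_completely_regular_space)
  obtain F where F: "usco_map baire_space X F"
    and cov: "\<And>L. compactin X L \<Longrightarrow> \<exists>\<sigma>. L \<subseteq> F \<sigma>"
    using assms(3) unfolding strongly_K_analytic_def by auto
  have FX: "F \<sigma> \<subseteq> topspace X" for \<sigma>
    using F by (auto simp: usco_map_def nonempty_compacts_def Pi_iff dest: compactin_subset_topspace)
  \<comment> \<open>The values of \<open>F\<close> are moved into the compact cube \<open>Z\<close>
    before the graph is formed, since the graph lemma needs a compact Hausdorff target.\<close>
  define C where "C = {(baire_embedding \<sigma>, x) |\<sigma> x. x \<in> e ` F \<sigma>}"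
  have C: "strongly_K_sigma_delta \<Omega> C"
    unfolding \<Omega>_def C_def
    by (rule strongly_K_sigma_delta_usco_graph[OF usco_map_compose_continuous[OF F e] Z])
  \<comment> \<open>The inverse \<open>e'\<close> is continuous only on the image of
    \<open>X\<close>, so the projection of \<open>C\<close> must be shown to land there.\<close>
  have "continuous_map (subtopology \<Omega> C) (subtopology Z (e ` topspace X)) snd"
    unfolding continuous_map_in_subtopology \<Omega>_def
  proof
    show "continuous_map (subtopology (prod_topology hilbert_cube Z) C) Z snd"
      by (simp add: continuous_map_from_subtopology continuous_map_snd)
    have "snd c \<in> e ` topspace X" if c: "c \<in> C" for c
    proof -
      obtain \<sigma> x where "c = (baire_embedding \<sigma>, e x)" "x \<in> F \<sigma>"
        using c unfolding C_def by blast
      then show ?thesis using FX[of \<sigma>] by auto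
    qed
    then show "snd \<in> topspace (subtopology (prod_topology hilbert_cube Z) C) \<rightarrow> e ` topspace X"
      by simp
  qed
  then have "continuous_map (subtopology \<Omega> C) X (e' \<circ> snd)"
    using e' continuous_map_compose by blast
  moreover have "\<exists>K. compactin (subtopology \<Omega> C) K \<and> (e' \<circ> snd) ` K = L" if L: "compactin X L" for L
  proof -
    obtain \<sigma> where \<sigma>: "L \<subseteq> F \<sigma>" using cov L by blast
    \<comment> \<open>A slice over one point suffices: \<open>L\<close> lies in the single value
      \<open>F \<sigma>\<close>, so the copy of \<open>L\<close> over \<open>\<sigma>\<close> is
      contained in the graph.\<close>
    let ?K = "{baire_embedding \<sigma>} \<times> e ` L"
    have "compactin \<Omega> ?K"
      using image_compactin[OF L e] baire_embedding_in_cube[of \<sigma>]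
      by (simp add: \<Omega>_def compactin_Times del: topspace_product_topology)
    moreover have "?K \<subseteq> C" using \<sigma> by (auto simp: C_def)
    moreover have "(e' \<circ> snd) ` ?K = L"
      using e'e FX[of \<sigma>] \<sigma> by force
    ultimately show ?thesis by (metis compactin_subtopology)
  qed
  ultimately have "compact_covering_map (subtopology \<Omega> C) X (e' \<circ> snd)"
    by (simp add: compact_covering_map_def)
  then show ?thesis
    unfolding compact_covering_from_def
    using \<Omega> \<open>completely_regular_space \<Omega>\<close> C by blast
qed

theorem theorem1p13:
  fixes X :: "'a topology"
  assumes "Hausdorff_space X" and "completely_regular_space X" and "topspace X \<noteq> {}"
  shows "(strongly_K_analytic X \<longleftrightarrow>
            (\<exists>\<Omega> :: 'a compact_carrier topology. compact_covering_from \<Omega> X)) \<and>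
         ((\<exists>\<Omega> :: 'b topology. compact_covering_from \<Omega> X) \<longrightarrow> strongly_K_analytic X)"
proof (intro conjI iffI impI)
  show "strongly_K_analytic X"
    if "\<exists>\<Omega> :: 'a compact_carrier topology. compact_covering_from \<Omega> X"
    using that compact_covering_from_imp_strongly_K_analytic[OF _ assms(3)] by (elim exE)
  show "strongly_K_analytic X"
    if "\<exists>\<Omega> :: 'b topology. compact_covering_from \<Omega> X"
    using that compact_covering_from_imp_strongly_K_analytic[OF _ assms(3)] by (elim exE)
qed (rule strongly_K_analytic_imp_compact_covering_from[OF assms(1,2)])

end
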